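(* Let $n\geq1$ and $Z_n(x,t):=\sum_{d\geq0}P_{d,n}(x)t^d\in\mathbb{Q}[x][[t]]$. Then $Z_n(x,t)$ is a rational function in $t$ with coefficients in $\mathbb{Q}[x]$ if and only if $n=1$. However, for every root of unity $\zeta$, $Z_n(\zeta,t)$ is a rational function in $t$ with coefficients in $\mathbb{Q}(\zeta)$.
   Context: $P_{d,n}(x):=\dfrac{x^{\binom{d+n}{n}}-x^{\binom{d+n-1}{n}}}{x-1}\in\mathbb{Z}[x]$; for a prime power $q$, $P_{d,n}(q)$ is the number of monic (i.e. up to $\mathbb{F}_q^\times$-scaling) polynomials of total degree $d$ in $\mathbb{F}_q[x_1,\dots,x_n]$. *)

theory Defs
  imports "HOL-Computational_Algebra.Computational_Algebra" Complex_Main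
begin

text \<open>The division below is the exact division of \<^typ>\<open>int poly\<close>; see \<open>P_poly_mult\<close>.\<close>

definition P_poly :: "nat \<Rightarrow> nat \<Rightarrow> int poly" where
  "P_poly d n =
     (monom 1 ((d + n) choose n) - monom 1 ((d + n - 1) choose n)) div [:-1, 1:]"

lemma P_poly_mult:
  "P_poly d n * [:-1, 1:] = monom 1 ((d + n) choose n) - monom 1 ((d + n - 1) choose n)"
proof -
  have "[:-1, 1:] dvd (monom 1 ((d + n) choose n) - monom 1 ((d + n - 1) choose n) :: int poly)"
    using poly_eq_0_iff_dvd[of "monom 1 ((d + n) choose n) - monom 1 ((d + n - 1) choose n) :: int poly" 1]
    by (simp add: poly_monom)
  thus ?thesis
    unfolding P_poly_def by (rule dvd_div_mult_self)
qed

definition Z_series :: "nat \<Rightarrow> rat poly fps" where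
  "Z_series n = Abs_fps (\<lambda>d. map_poly of_int (P_poly d n))"

text \<open>Substitution of a complex number for the inner variable \<open>x\<close>, coefficient by coefficient
  in the outer variable \<open>t\<close>.\<close>

definition specialize :: "rat poly fps \<Rightarrow> complex \<Rightarrow> complex fps" where
  "specialize F \<zeta> = Abs_fps (\<lambda>d. poly (map_poly of_rat (fps_nth F d)) \<zeta>)"

text \<open>\<open>f = p / q\<close> in the fraction field of the ring of power series, where \<open>p\<close> and
  \<open>q \<noteq> 0\<close> are polynomials with coefficients in the subring \<open>R\<close>.\<close>

definition rational_function_over :: "'a::idom set \<Rightarrow> 'a fps \<Rightarrow> bool" where
  "rational_function_over R f \<longleftrightarrow>
     (\<exists>p q. (\<forall>i. coeff p i \<in> R) \<and> (\<forall>i. coeff q i \<in> R) \<and> q \<noteq> 0 \<and>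
            f * fps_of_poly q = fps_of_poly p)"

definition is_subfield :: "'a::field set \<Rightarrow> bool" where
  "is_subfield K \<longleftrightarrow> 0 \<in> K \<and> 1 \<in> K \<and>
     (\<forall>a\<in>K. \<forall>b\<in>K. a + b \<in> K \<and> a * b \<in> K) \<and>
     (\<forall>a\<in>K. - a \<in> K \<and> inverse a \<in> K)"

definition rat_adjoin :: "complex \<Rightarrow> complex set" where
  "rat_adjoin \<zeta> = is_subfield hull (insert \<zeta> \<rat>)"

definition root_of_unity :: "complex \<Rightarrow> bool" where
  "root_of_unity \<zeta> \<longleftrightarrow> (\<exists>m::nat. m > 0 \<and> \<zeta> ^ m = 1)"

end

theory Submission
  imports Defs "HOL-Number_Theory.Cong"
begin

text \<open>
  For \<open>n \<ge> 2\<close> the gap \<open>(d + n choose n) - (d + n - 1 choose n)\<close> between the \<open>x\<close>-degrees of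
  consecutive coefficients of \<open>Z\<^sub>n\<close> is unbounded, so in a linear recurrence with coefficients in
  \<open>\<rat>[x]\<close> the term of top degree is eventually not cancelled. At a root of unity \<open>\<zeta> \<noteq> 1\<close> with
  \<open>\<zeta>\<^sup>m = 1\<close> the coefficients are periodic in \<open>d\<close>, because binomial coefficients modulo \<open>m\<close> are.
  At \<open>\<zeta> = 1\<close> the series is \<open>1 / (1 - t)\<^sup>n\<close>.
\<close>

section \<open>Binomial coefficients modulo \<open>m\<close>\<close>

lemma choose_mod_periodic:
  fixes m n :: nat
  assumes "m > 0"
  obtains T where "T > 0" "\<And>d. [(d + T) choose n = d choose n] (mod m)"
proof
  \<comment> \<open>In the absorption identity used for \<open>dvd\<close>, the factor
    \<open>fact n\<close> pays for the division by \<open>k\<close>, for every \<open>k\<close> in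
    \<open>1..n\<close> at once, and \<open>m\<close> survives.\<close>
  define T where "T = m * fact n"
  show "T > 0" using assms by (simp add: T_def)
  have dvd: "m dvd (T choose k)" if "1 \<le> k" "k \<le> n" for k
  proof -
    have "k dvd fact n" using that by (simp add: dvd_fact)
    then obtain c where c: "fact n = k * c" ..
    have "k * (T choose k) = T * ((T - 1) choose (k - 1))"
      using that \<open>T > 0\<close> by (intro times_binomial_minus1_eq) auto
    also have "\<dots> = k * (m * c * ((T - 1) choose (k - 1)))"
      by (simp add: T_def c mult_ac)
    finally have "T choose k = m * c * ((T - 1) choose (k - 1))"
      using that by simp
    thus ?thesis by simp
  qed
  show "[(d + T) choose n = d choose n] (mod m)" for d
  proof -
    \<comment> \<open>Vandermonde's convolution isolates \<open>d choose n\<close> at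
      \<open>k = 0\<close>; every other summand contains a \<open>T choose k\<close> divisible by
      \<open>m\<close>.\<close>
    have "(d + T) choose n = (\<Sum>k\<le>n. (T choose k) * (d choose (n - k)))"
      by (subst add.commute, rule vandermonde[symmetric])
    also have "\<dots> = (d choose n) + (\<Sum>k\<in>{..n} - {0}. (T choose k) * (d choose (n - k)))"
      by (subst sum.remove[of _ 0]) auto
    finally have eq: "(d + T) choose n =
        (d choose n) + (\<Sum>k\<in>{..n} - {0}. (T choose k) * (d choose (n - k)))" .
    have "m dvd (\<Sum>k\<in>{..n} - {0}. (T choose k) * (d choose (n - k)))"
      by (intro dvd_sum dvd_mult2 dvd) auto
    thus ?thesis
      unfolding eq by (simp add: cong_def dvd_eq_mod_eq_0 mod_add_right_eq[symmetric])
  qed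
qed

section \<open>Degrees and values of \<open>P_poly\<close>\<close>

lemma choose_pred_add:
  assumes "n \<ge> 1"
  shows "(d + n) choose n = ((d + n - 1) choose n) + ((d + n - 1) choose (n - 1))"
  using assms by (cases n) simp_all

text \<open>Used with \<open>j = n - 1\<close>, this is where \<open>n \<ge> 2\<close> enters: it
  makes the degree gaps of \<open>Z_series n\<close> unbounded.\<close>

lemma le_choose_add:
  "M < (M + j) choose j" if "j \<ge> 1" for M j :: nat
  using that by (induction j rule: nat_induct_at_least) auto

text \<open>Multiplying by \<open>[:-1, 1:]\<close> only shifts and subtracts, so the integer
  identity transfers coefficient by coefficient. It is applied over the rationals for degrees and
  over the complex numbers for values.\<close>

lemma of_int_P_poly_mult:
  "map_poly of_int (P_poly d n) * [:-1, 1:] =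
     (monom 1 ((d + n) choose n) - monom 1 ((d + n - 1) choose n) :: 'a :: {idom, ring_char_0} poly)"
proof (rule poly_eqI)
  fix i
  have "of_int (coeff (P_poly d n * [:-1, 1:]) i) =
      (of_int (coeff (monom 1 ((d + n) choose n) - monom 1 ((d + n - 1) choose n)) i) :: 'a)"
    by (simp only: P_poly_mult)
  thus "coeff (map_poly of_int (P_poly d n) * [:-1, 1:]) i =
      coeff (monom 1 ((d + n) choose n) - monom 1 ((d + n - 1) choose n) :: 'a poly) i"
    by (cases i) (auto simp: coeff_map_poly split: if_splits)
qed

lemma poly_P_poly_mult:
  "poly (map_poly of_int (P_poly d n)) z * (z - 1) =
     z ^ ((d + n) choose n) - z ^ ((d + n - 1) choose n)"
  for z :: "'a :: {idom, ring_char_0}"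
  using arg_cong[OF of_int_P_poly_mult[of d n], of "\<lambda>p. poly p z"]
  by (simp add: poly_monom algebra_simps)

text \<open>At 1 the product identity degenerates to \<open>0 = 0\<close>, so its derivative is
  evaluated instead: the left side leaves the value of \<open>P_poly\<close>, the right side the
  difference of the two exponents.\<close>

lemma poly_P_poly_1:
  assumes "n \<ge> 1"
  shows "poly (map_poly of_int (P_poly d n)) (1 :: 'a :: {idom, ring_char_0}) =
    of_nat ((d + n - 1) choose (n - 1))"
  using arg_cong[OF of_int_P_poly_mult[of d n, where 'a = 'a], of "\<lambda>p. poly (pderiv p) 1"]
  by (simp add: pderiv_mult pderiv_pCons pderiv_diff pderiv_monom poly_monom
      choose_pred_add[OF assms, of d])

lemma degree_P_poly:
  assumes "n \<ge> 1"
  shows "degree (map_poly of_int (P_poly d n) :: 'a :: {idom, ring_char_0} poly) + 1 =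
    (d + n) choose n" (is "degree ?A + 1 = _")
    and "map_poly of_int (P_poly d n) \<noteq> (0 :: 'a poly)"
proof -
  have less: "(d + n - 1) choose n < (d + n) choose n"
    using choose_pred_add[OF assms, of d] assms by simp
  have deg: "degree (?A * [:-1, 1:]) = (d + n) choose n"
    unfolding of_int_P_poly_mult diff_conv_add_uminus
    by (subst degree_add_eq_left) (use less in \<open>simp_all add: degree_monom_eq\<close>)
  show nz: "?A \<noteq> 0"
    using deg less by auto
  show "degree ?A + 1 = (d + n) choose n"
    using deg nz by (subst (asm) degree_mult_eq) auto
qed

section \<open>Failure of rationality for \<open>n \<ge> 2\<close>\<close>

lemma Z_series_not_rational:
  assumes "n \<ge> 2"
  shows "\<not> rational_function_over UNIV (Z_series n)"
proof
  assume "rational_function_over UNIV (Z_series n)"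
  then obtain p q where q: "q \<noteq> 0" and eq: "Z_series n * fps_of_poly q = fps_of_poly p"
    unfolding rational_function_over_def by blast
  define A where "A = (\<lambda>d. map_poly of_int (P_poly d n) :: rat poly)"
  have deg_A: "degree (A d) + 1 = (d + n) choose n" and A_nz: "A d \<noteq> 0" for d
    using degree_P_poly[of n d, where 'a = rat] assms unfolding A_def by simp_all
  \<comment> \<open>With \<open>k\<close> the order of \<open>q\<close> in \<open>t\<close>, the
    coefficient of \<open>t\<close> to the power \<open>M + k\<close> in the product involves only
    \<open>A 0, ..., A M\<close>, and \<open>A M\<close> occurs with the nonzero factor
    \<open>coeff q k\<close>.\<close>
  define k where "k = (LEAST j. coeff q j \<noteq> 0)"
  have k: "coeff q k \<noteq> 0"
    unfolding k_def by (rule LeastI[of _ "degree q"]) (use q in simp)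
  have k_least: "coeff q j = 0" if "j < k" for j
    using that not_less_Least unfolding k_def by blast
  define D where "D = (\<Sum>j\<le>degree q. degree (coeff q j))"
  have D: "degree (coeff q j) \<le> D" for j
  proof (cases "j \<le> degree q")
    case True
    thus ?thesis unfolding D_def by (intro member_le_sum) auto
  qed (simp add: coeff_eq_0)
  \<comment> \<open>\<open>M\<close> exceeds \<open>degree p\<close>, so that coefficient of
    \<open>p\<close> vanishes; \<open>M\<close> exceeds \<open>D\<close>, so the degree jump before
    \<open>A M\<close> outweighs any coefficient of \<open>q\<close>.\<close>
  define M where "M = D + degree p + 1"
  have gap: "degree (A i) + D < degree (A M)" if "i < M" for i
  proof -
    have "(i + n) choose n \<le> (M + n - 1) choose n"
      using that by (intro binomial_right_mono) simp
    moreover have "M < (M + n - 1) choose (n - 1)"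
      using le_choose_add[of "n - 1" M] assms by simp
    ultimately show ?thesis
      using deg_A[of i] deg_A[of M] choose_pred_add[of n M] assms by (simp add: M_def)
  qed
  have "0 = coeff p (M + k)"
    by (rule coeff_eq_0[symmetric]) (simp add: M_def)
  also have "\<dots> = fps_nth (Z_series n * fps_of_poly q) (M + k)"
    by (simp add: eq)
  also have "\<dots> = (\<Sum>i=0..M + k. A i * coeff q (M + k - i))"
    by (simp add: fps_mult_nth Z_series_def A_def)
  also have "\<dots> = (\<Sum>i\<le>M. A i * coeff q (M + k - i))"
    by (intro sum.mono_neutral_right) (auto intro!: k_least)
  also have "\<dots> = A M * coeff q k + (\<Sum>i<M. A i * coeff q (M + k - i))"
    by (simp add: lessThan_Suc_atMost[symmetric])
  finally have zero: "A M * coeff q k + (\<Sum>i<M. A i * coeff q (M + k - i)) = 0" by simp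
  have "degree (\<Sum>i<M. A i * coeff q (M + k - i)) < degree (A M)"
  proof (rule degree_sum_less)
    fix i assume "i \<in> {..<M}"
    have "degree (A i * coeff q (M + k - i)) \<le> degree (A i) + D"
      using degree_mult_le[of "A i" "coeff q (M + k - i)"] D[of "M + k - i"] by linarith
    also have "\<dots> < degree (A M)" using gap \<open>i \<in> {..<M}\<close> by simp
    finally show "degree (A i * coeff q (M + k - i)) < degree (A M)" .
  qed (use gap[of 0] in \<open>simp add: M_def\<close>)
  moreover have "degree (A M) \<le> degree (A M * coeff q k)"
    using A_nz k by (simp add: degree_mult_eq)
  \<comment> \<open>The term with \<open>A M\<close> strictly dominates, so a sum that is zero would
    have the degree of that term, which is positive.\<close>
  ultimately have "degree (A M * coeff q k + (\<Sum>i<M. A i * coeff q (M + k - i))) =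
      degree (A M * coeff q k)"
    by (intro degree_add_eq_left) simp
  with zero \<open>degree (A M) \<le> degree (A M * coeff q k)\<close> gap[of 0] show False
    by (simp add: M_def)
qed

text \<open>Here \<open>P_poly d 1\<close> is the monomial of degree \<open>d\<close>, and the
  series is geometric: \<open>1 / (1 - x t)\<close>, with \<open>x\<close> the inner
  variable.\<close>

lemma Z_series_1_rational: "rational_function_over UNIV (Z_series 1)"
proof -
  have P: "map_poly of_int (P_poly d 1) = (monom 1 d :: rat poly)" for d
  proof -
    have "map_poly of_int (P_poly d 1) * [:-1, 1:] = (monom 1 d * [:-1, 1:] :: rat poly)"
      unfolding of_int_P_poly_mult by (simp add: monom_Suc)
    thus ?thesis by (subst (asm) mult_right_cancel) simp_all
  qed
  have "Z_series 1 * fps_of_poly [:1, - monom 1 1:] = fps_of_poly 1"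
  proof (rule fps_ext)
    fix d
    show "fps_nth (Z_series 1 * fps_of_poly [:1, - monom 1 1:]) d = fps_nth (fps_of_poly 1) d"
      by (cases d)
        (simp_all add: Z_series_def P[unfolded One_nat_def] fps_of_poly_pCons algebra_simps mult_monom)
  qed
  thus ?thesis
    unfolding rational_function_over_def by (intro exI[of _ 1] exI[of _ "[:1, - monom 1 1:]"]) auto
qed

section \<open>Coefficients in the field generated by \<open>\<zeta>\<close>\<close>

lemma is_subfield_rat_adjoin: "is_subfield (rat_adjoin \<zeta>)"
  unfolding rat_adjoin_def by (rule hull_in) (auto simp: is_subfield_def)

lemma subset_rat_adjoin: "insert \<zeta> \<rat> \<subseteq> rat_adjoin \<zeta>"
  unfolding rat_adjoin_def by (rule hull_subset)

lemma rat_adjoin_add: "a \<in> rat_adjoin \<zeta> \<Longrightarrow> b \<in> rat_adjoin \<zeta> \<Longrightarrow> a + b \<in> rat_adjoin \<zeta>"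
  and rat_adjoin_mult: "a \<in> rat_adjoin \<zeta> \<Longrightarrow> b \<in> rat_adjoin \<zeta> \<Longrightarrow> a * b \<in> rat_adjoin \<zeta>"
  using is_subfield_rat_adjoin[of \<zeta>] unfolding is_subfield_def by blast+

lemma rat_adjoin_sum:
  "(\<And>i. i \<in> A \<Longrightarrow> f i \<in> rat_adjoin \<zeta>) \<Longrightarrow> sum f A \<in> rat_adjoin \<zeta>"
  by (induction A rule: infinite_finite_induct)
    (use subset_rat_adjoin[of \<zeta>] in \<open>auto intro: rat_adjoin_add\<close>)

lemma poly_of_rat_in_rat_adjoin: "poly (map_poly of_rat r) \<zeta> \<in> rat_adjoin \<zeta>"
proof (induction r)
  case 0
  thus ?case using subset_rat_adjoin[of \<zeta>] by auto
next
  case (pCons a r)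
  have "of_rat a \<in> rat_adjoin \<zeta>" "\<zeta> \<in> rat_adjoin \<zeta>"
    using subset_rat_adjoin[of \<zeta>] by auto
  thus ?case using pCons by (simp add: map_poly_pCons rat_adjoin_add rat_adjoin_mult)
qed

text \<open>The numerator inherits its coefficients from the field: each is a finite sum of products
  of coefficients of \<open>q\<close> and of the series, and the latter are values at
  \<open>\<zeta>\<close> of rational polynomials.\<close>

lemma rational_function_over_specializeI:
  assumes "q \<noteq> 0" and q: "\<And>i. coeff q i \<in> rat_adjoin \<zeta>"
    and eq: "specialize F \<zeta> * fps_of_poly q = fps_of_poly p"
  shows "rational_function_over (rat_adjoin \<zeta>) (specialize F \<zeta>)"
  unfolding rational_function_over_def
proof (intro exI conjI allI)
  fix i
  have "coeff p i = fps_nth (specialize F \<zeta> * fps_of_poly q) i" by (simp add: eq)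
  also have "\<dots> \<in> rat_adjoin \<zeta>"
    unfolding fps_mult_nth specialize_def
    by (intro rat_adjoin_sum) (simp add: rat_adjoin_mult q poly_of_rat_in_rat_adjoin)
  finally show "coeff p i \<in> rat_adjoin \<zeta>" .
qed (use assms in auto)

lemma nth_specialize_Z_series:
  "fps_nth (specialize (Z_series n) \<zeta>) d = poly (map_poly of_int (P_poly d n)) \<zeta>"
  by (simp add: specialize_def Z_series_def map_poly_map_poly o_def)

section \<open>The case \<open>\<zeta> = 1\<close>\<close>

lemma binomial_series_mult_power:
  "Abs_fps (\<lambda>d. of_nat ((d + k) choose k)) * (1 - fps_X) ^ Suc k = (1 :: 'a :: comm_ring_1 fps)"
proof (induction k)
  case 0
  show ?case by (rule fps_ext) (simp add: algebra_simps)
next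
  case (Suc k)
  \<comment> \<open>One factor \<open>1 - fps_X\<close> takes differences of consecutive
    coefficients, which by Pascal's rule lowers \<open>Suc k\<close> to \<open>k\<close>.\<close>
  have "Abs_fps (\<lambda>d. of_nat ((d + Suc k) choose Suc k)) * (1 - fps_X) =
      (Abs_fps (\<lambda>d. of_nat ((d + k) choose k)) :: 'a fps)"
  proof (rule fps_ext)
    fix d
    show "fps_nth (Abs_fps (\<lambda>d. of_nat ((d + Suc k) choose Suc k)) * (1 - fps_X)) d =
        fps_nth (Abs_fps (\<lambda>d. of_nat ((d + k) choose k)) :: 'a fps) d"
      by (cases d) (simp_all add: right_diff_distrib binomial_eq_0)
  qed
  thus ?case
    using Suc by (simp only: power_Suc[of _ "Suc k"] mult.assoc[symmetric])
qed

lemma coeff_pCons_power_in_Ints: "coeff ([:1, -1:] ^ k) i \<in> (\<int> :: 'a :: comm_ring_1 set)"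
proof (induction k arbitrary: i)
  case (Suc k)
  thus ?case by (cases i) auto
qed auto

lemma specialize_Z_series_1_rational:
  assumes "n \<ge> 1"
  shows "rational_function_over (rat_adjoin 1) (specialize (Z_series n) 1)"
proof (rule rational_function_over_specializeI)
  show "coeff ([:1, -1:] ^ n) i \<in> rat_adjoin 1" for i
    using coeff_pCons_power_in_Ints[of n i] Ints_subset_Rats subset_rat_adjoin[of 1] by blast
  have "specialize (Z_series n) 1 = Abs_fps (\<lambda>d. of_nat ((d + (n - 1)) choose (n - 1)))"
    by (rule fps_ext) (use assms in \<open>simp add: nth_specialize_Z_series poly_P_poly_1\<close>)
  moreover have "fps_of_poly ([:1, -1:] ^ n) = (1 - fps_X :: complex fps) ^ Suc (n - 1)"
    using assms by (simp add: fps_of_poly_power fps_of_poly_pCons)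
  ultimately show "specialize (Z_series n) 1 * fps_of_poly ([:1, -1:] ^ n) = fps_of_poly 1"
    by (simp only: binomial_series_mult_power fps_of_poly_1)
qed simp

section \<open>Roots of unity other than 1\<close>

lemma power_eq_if_cong:
  fixes z :: "'a :: monoid_mult"
  assumes "z ^ m = 1" "[a = b] (mod m)"
  shows "z ^ a = z ^ b"
proof -
  have "z ^ c = z ^ (c mod m)" for c
  proof -
    have "z ^ c = z ^ (m * (c div m) + c mod m)" by simp
    also have "\<dots> = z ^ (c mod m)" by (simp only: power_add power_mult assms(1)) simp
    finally show ?thesis .
  qed
  thus ?thesis using assms(2) unfolding cong_def by metis
qed

text \<open>Times \<open>\<zeta> - 1\<close>, the coefficients are differences of powers of
  \<open>\<zeta>\<close>, whose exponents matter only modulo \<open>m\<close>. One period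
  \<open>T\<close> serves both binomials, and \<open>\<zeta> \<noteq> 1\<close> permits
  cancelling.\<close>

lemma specialize_Z_series_periodic:
  assumes n: "n \<ge> 1" and m: "m > 0" "\<zeta> ^ m = 1" and "\<zeta> \<noteq> 1"
  obtains T where "T > 0"
    "\<And>d. fps_nth (specialize (Z_series n) \<zeta>) (d + T) = fps_nth (specialize (Z_series n) \<zeta>) d"
proof -
  obtain T where T: "T > 0" "\<And>d. [(d + T) choose n = d choose n] (mod m)"
    using choose_mod_periodic[OF m(1)] by blast
  show ?thesis
  proof (rule that[OF T(1)])
    fix d
    have "\<zeta> ^ ((d + T + n) choose n) = \<zeta> ^ ((d + n) choose n)"
      using power_eq_if_cong[OF m(2) T(2)[of "d + n"]] by (simp add: add_ac)
    \<comment> \<open>Since \<open>n \<ge> 1\<close>, the natural subtraction is exact and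
      \<open>d + T + n - 1\<close> is \<open>d + n - 1\<close> shifted by \<open>T\<close>.\<close>
    moreover have "\<zeta> ^ ((d + T + n - 1) choose n) = \<zeta> ^ ((d + n - 1) choose n)"
      using power_eq_if_cong[OF m(2) T(2)[of "d + n - 1"]] n by (simp add: add_ac)
    ultimately have "poly (map_poly of_int (P_poly (d + T) n)) \<zeta> * (\<zeta> - 1) =
        poly (map_poly of_int (P_poly d n)) \<zeta> * (\<zeta> - 1)"
      by (simp only: poly_P_poly_mult)
    thus "fps_nth (specialize (Z_series n) \<zeta>) (d + T) = fps_nth (specialize (Z_series n) \<zeta>) d"
      using \<open>\<zeta> \<noteq> 1\<close> by (simp add: nth_specialize_Z_series)
  qed
qed

text \<open>From index \<open>T\<close> on, the product has coefficients
  \<open>f_d - f_(d-T) = 0\<close>; below \<open>T\<close> the coefficients of \<open>f\<close>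
  remain.\<close>

lemma periodic_fps_mult:
  fixes f :: "'a :: comm_ring_1 fps"
  assumes "\<And>d. fps_nth f (d + T) = fps_nth f d"
  shows "f * fps_of_poly (1 - monom 1 T) = fps_of_poly (truncate_fps T f)"
proof (rule fps_ext)
  fix d
  show "fps_nth (f * fps_of_poly (1 - monom 1 T)) d = fps_nth (fps_of_poly (truncate_fps T f)) d"
    using assms[of "d - T"]
    by (cases "d < T") (simp_all add: fps_of_poly_diff fps_of_poly_monom right_diff_distrib
        fps_X_power_mult_right_nth coeff_truncate_fps)
qed

lemma specialize_Z_series_rational:
  assumes n: "n \<ge> 1" and "root_of_unity \<zeta>"
  shows "rational_function_over (rat_adjoin \<zeta>) (specialize (Z_series n) \<zeta>)"
proof (cases "\<zeta> = 1")
  case True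
  thus ?thesis using specialize_Z_series_1_rational[OF n] by simp
next
  case False
  obtain m where m: "m > 0" "\<zeta> ^ m = 1"
    using assms(2) unfolding root_of_unity_def by blast
  obtain T where T: "T > 0"
    "\<And>d. fps_nth (specialize (Z_series n) \<zeta>) (d + T) = fps_nth (specialize (Z_series n) \<zeta>) d"
    using specialize_Z_series_periodic[OF n m False] by blast
  show ?thesis
  proof (rule rational_function_over_specializeI)
    show "specialize (Z_series n) \<zeta> * fps_of_poly (1 - monom 1 T) =
        fps_of_poly (truncate_fps T (specialize (Z_series n) \<zeta>))"
      using T(2) by (rule periodic_fps_mult)
    \<comment> \<open>Because \<open>T > 0\<close>, the monomial does not reach the constant term,
      which stays 1.\<close>
    have "coeff (1 - monom 1 T :: complex poly) 0 \<noteq> 0" using T(1) by simp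
    thus "1 - monom 1 T \<noteq> (0 :: complex poly)" by (metis coeff_0)
    have "coeff (1 - monom 1 T) i \<in> \<rat>" for i by (auto simp: coeff_1)
    thus "coeff (1 - monom 1 T) i \<in> rat_adjoin \<zeta>" for i
      using subset_rat_adjoin[of \<zeta>] by blast
  qed
qed

theorem theorem5p10:
  fixes n :: nat
  assumes "n \<ge> 1"
  shows "(rational_function_over (UNIV :: rat poly set) (Z_series n) \<longleftrightarrow> n = 1) \<and>
         (\<forall>\<zeta>. root_of_unity \<zeta> \<longrightarrow>
            rational_function_over (rat_adjoin \<zeta>) (specialize (Z_series n) \<zeta>))"
proof (intro conjI allI impI iffI)
  assume "rational_function_over (UNIV :: rat poly set) (Z_series n)"
  thus "n = 1" using Z_series_not_rational[of n] assms by (cases "n \<ge> 2") auto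
next
  assume "n = 1"
  thus "rational_function_over (UNIV :: rat poly set) (Z_series n)"
    using Z_series_1_rational by simp
next
  fix \<zeta> assume "root_of_unity \<zeta>"
  with assms show "rational_function_over (rat_adjoin \<zeta>) (specialize (Z_series n) \<zeta>)"
    by (rule specialize_Z_series_rational)
qed

end
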